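(* Let $(\Omega,\Sigma,\mu)$ be a finite atomless measure space, let $X$ be a Köthe $F$-space on $(\Omega,\Sigma,\mu)$, let $Z$ be the set of all signs in $X$, and let $Y$ be a locally convex $F$-space. Let $T_1\in\mathcal L(X,Y)$ be a narrow operator and let $T_2\in\mathcal L(X,Y)$ be a narrow operator such that the set $K=T_2(Z)$ is relatively compact in $Y$. Then the operator $T=T_1+T_2$ is narrow.
   Context: All spaces are over the same scalar field $\mathbb K\in\{\mathbb R,\mathbb C\}$. $\mathcal L(X,Y)$ denotes the space of all continuous linear operators $X\to Y$. $\Sigma^+$ is the set of all $A\in\Sigma$ with $\mu(A)>0$. $L_0(\mu)$ is the linear space of all equivalence classes of $\Sigma$-measurable functions $x:\Omega\to\mathbb K$; $\mathbf 1_A$ is the characteristic function of $A\in\Sigma$. An $F$-space is a complete metric linear space with a translation-invariant metric $\rho$; its $F$-norm is $\|x\|=\rho(x,0)$. It is assumed throughout that $\|\alpha x\|\le\|x\|$ for every vector $x$ and every scalar $\alpha$ with $|\alpha|\le 1$. A Köthe $F$-space on $(\Omega,\Sigma,\mu)$ is an $F$-space $X$ that is a linear subspace of $L_0(\mu)$, such that $\mathbf 1_\Omega\in X$, and such that for all $x\in L_0(\mu)$ and $y\in X$ the condition $|x|\le|y|$ implies $x\in X$ and $\|x\|\le\|y\|$. A sign is a $\{-1,0,1\}$-valued element $x\in L_0(\mu)$. It is a sign on $A\in\Sigma$ if $\operatorname{supp}x=A$ (up to null sets). It is of mean zero if $\int x\,d\mu=0$. An operator $T\in\mathcal L(X,Y)$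 is narrow if for every $A\in\Sigma^+$ and every $\varepsilon>0$ there is a mean zero sign $x$ on $A$ with $\|Tx\|<\varepsilon$. *)

theory Defs
  imports "HOL-Analysis.Analysis" "HOL-Library.Function_Algebras"
begin

text \<open>
  The scalar field is \<open>\<real>\<close> or \<open>\<complex>\<close>. The second alternative says that the field is \<open>\<real>(i)\<close> with
  \<open>i\<^sup>2 = -1\<close>; the multiplicativity of the norm then forces it to be the usual modulus.
\<close>

class real_or_complex = real_normed_field + banach + second_countable_topology +
  assumes real_or_complex:
    "(\<forall>z. \<exists>a. z = a *\<^sub>R 1) \<or>
     (\<exists>i. i * i = - 1 \<and> (\<forall>z. \<exists>a b. z = a *\<^sub>R 1 + b *\<^sub>R i))"

instance real :: real_or_complex
  by standard simp

instance complex :: real_or_complex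
proof
  have "\<exists>a b. z = a *\<^sub>R 1 + b *\<^sub>R \<i>" for z
    by (intro exI[of _ "Re z"] exI[of _ "Im z"]) (simp add: complex_eq_iff)
  then show "(\<forall>z. \<exists>a. z = a *\<^sub>R (1::complex)) \<or>
      (\<exists>i::complex. i * i = - 1 \<and> (\<forall>z. \<exists>a b. z = a *\<^sub>R 1 + b *\<^sub>R i))"
    by (intro disjI2 exI[of _ "\<i>"]) simp
qed


text \<open>
  An \<open>F\<close>-space is presented by representatives: \<open>V\<close> is a linear subspace of \<open>'v\<close>, two elements of
  \<open>V\<close> are the same point iff their difference lies in \<open>E\<close>, and \<open>\<rho>\<close> is the metric of the quotient
  read on representatives. For \<open>V = UNIV\<close> and \<open>E = {0}\<close> this is an \<open>F\<close>-space in the literal sense;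
  for subspaces of \<open>L\<^sub>0\<close> the set \<open>E\<close> consists of the functions that vanish almost everywhere.
  Continuity of addition is a consequence of translation invariance. The \<open>F\<close>-norm of \<open>x\<close> is
  \<open>\<rho> x 0\<close>.
\<close>

locale F_space = vector_space scl
  for scl :: "'k::real_normed_field \<Rightarrow> 'v::ab_group_add \<Rightarrow> 'v" +
  fixes V E :: "'v set" and \<rho> :: "'v \<Rightarrow> 'v \<Rightarrow> real"
  assumes subspace_V: "subspace V"
    and nonneg: "x \<in> V \<Longrightarrow> y \<in> V \<Longrightarrow> 0 \<le> \<rho> x y"
    and zero_iff: "x \<in> V \<Longrightarrow> y \<in> V \<Longrightarrow> \<rho> x y = 0 \<longleftrightarrow> x - y \<in> E"
    and sym: "x \<in> V \<Longrightarrow> y \<in> V \<Longrightarrow> \<rho> x y = \<rho> y x"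
    and triangle: "x \<in> V \<Longrightarrow> y \<in> V \<Longrightarrow> z \<in> V \<Longrightarrow> \<rho> x z \<le> \<rho> x y + \<rho> y z"
    and translation_invariant:
      "x \<in> V \<Longrightarrow> y \<in> V \<Longrightarrow> z \<in> V \<Longrightarrow> \<rho> (x + z) (y + z) = \<rho> x y"
    and continuous_scl:
      "\<And>a \<alpha> u x. a \<longlonglongrightarrow> \<alpha> \<Longrightarrow> range u \<subseteq> V \<Longrightarrow> x \<in> V \<Longrightarrow> (\<lambda>n. \<rho> (u n) x) \<longlonglongrightarrow> 0 \<Longrightarrow>
        (\<lambda>n. \<rho> (scl (a n) (u n)) (scl \<alpha> x)) \<longlonglongrightarrow> 0"
    and complete:
      "\<And>u. range u \<subseteq> V \<Longrightarrow> (\<forall>\<epsilon>>0. \<exists>N::nat. \<forall>m\<ge>N. \<forall>n\<ge>N. \<rho> (u m) (u n) < \<epsilon>) \<Longrightarrow>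
        \<exists>x\<in>V. (\<lambda>n. \<rho> (u n) x) \<longlonglongrightarrow> 0"
    and scl_le: "norm \<alpha> \<le> 1 \<Longrightarrow> x \<in> V \<Longrightarrow> \<rho> (scl \<alpha> x) 0 \<le> \<rho> x 0"

definition locally_convex ::
  "('k::real_normed_field \<Rightarrow> 'y::{ab_group_add, metric_space} \<Rightarrow> 'y) \<Rightarrow> bool" where
  "locally_convex scl \<longleftrightarrow>
     (\<forall>U. open U \<and> 0 \<in> U \<longrightarrow>
       (\<exists>W. open W \<and> 0 \<in> W \<and> W \<subseteq> U \<and>
         (\<forall>x\<in>W. \<forall>y\<in>W. \<forall>t\<in>{0..1}. scl (of_real t) x + scl (of_real (1 - t)) y \<in> W)))"


definition fun_scl :: "'k::times \<Rightarrow> ('a \<Rightarrow> 'k) \<Rightarrow> 'a \<Rightarrow> 'k" where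
  "fun_scl c f = (\<lambda>t. c * f t)"

definition ae_zero :: "'a measure \<Rightarrow> ('a \<Rightarrow> 'k::zero) set" where
  "ae_zero M = {f. AE t in M. f t = 0}"

definition atomless :: "'a measure \<Rightarrow> bool" where
  "atomless M \<longleftrightarrow>
     (\<forall>A\<in>sets M. emeasure M A > 0 \<longrightarrow>
       (\<exists>B\<in>sets M. B \<subseteq> A \<and> 0 < emeasure M B \<and> emeasure M B < emeasure M A))"

text \<open>
  \<open>X\<close> is the set of all representatives of the elements of the space: the last condition makes it
  closed under equality almost everywhere.
\<close>

definition Koethe_F_space ::
  "'a measure \<Rightarrow> ('a \<Rightarrow> 'k::real_or_complex) set \<Rightarrow> (('a \<Rightarrow> 'k) \<Rightarrow> ('a \<Rightarrow> 'k) \<Rightarrow> real) \<Rightarrow> bool" where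
  "Koethe_F_space M X \<rho> \<longleftrightarrow>
     F_space fun_scl X (ae_zero M) \<rho> \<and>
     X \<subseteq> borel_measurable M \<and>
     indicator (space M) \<in> X \<and>
     (\<forall>x\<in>borel_measurable M. \<forall>y\<in>X.
       (AE t in M. norm (x t) \<le> norm (y t)) \<longrightarrow> x \<in> X \<and> \<rho> x 0 \<le> \<rho> y 0)"

text \<open>
  Continuity on the pseudometric set \<open>X\<close> forces the operator to take equal values on functions that
  are equal almost everywhere, so it is an operator on the classes.
\<close>

definition continuous_linear_operator ::
  "('a \<Rightarrow> 'k::real_or_complex) set \<Rightarrow> (('a \<Rightarrow> 'k) \<Rightarrow> ('a \<Rightarrow> 'k) \<Rightarrow> real) \<Rightarrow>
   ('k \<Rightarrow> 'y::{ab_group_add, metric_space} \<Rightarrow> 'y) \<Rightarrow> (('a \<Rightarrow> 'k) \<Rightarrow> 'y) \<Rightarrow> bool" where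
  "continuous_linear_operator X \<rho> scl T \<longleftrightarrow>
     (\<forall>x\<in>X. \<forall>y\<in>X. T (x + y) = T x + T y) \<and>
     (\<forall>c. \<forall>x\<in>X. T (fun_scl c x) = scl c (T x)) \<and>
     (\<forall>x\<in>X. \<forall>\<epsilon>>0. \<exists>\<delta>>0. \<forall>y\<in>X. \<rho> y x < \<delta> \<longrightarrow> dist (T y) (T x) < \<epsilon>)"

definition is_sign :: "'a measure \<Rightarrow> ('a \<Rightarrow> 'k::real_or_complex) \<Rightarrow> bool" where
  "is_sign M x \<longleftrightarrow> x \<in> borel_measurable M \<and> (AE t in M. x t \<in> {-1, 0, 1})"

definition sign_on :: "'a measure \<Rightarrow> 'a set \<Rightarrow> ('a \<Rightarrow> 'k::real_or_complex) \<Rightarrow> bool" where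
  "sign_on M A x \<longleftrightarrow> is_sign M x \<and> (AE t in M. x t \<noteq> 0 \<longleftrightarrow> t \<in> A)"

definition mean_zero :: "'a measure \<Rightarrow> ('a \<Rightarrow> 'k::real_or_complex) \<Rightarrow> bool" where
  "mean_zero M x \<longleftrightarrow> (\<integral>t. x t \<partial>M) = 0"

definition narrow_operator ::
  "'a measure \<Rightarrow> ('a \<Rightarrow> 'k::real_or_complex) set \<Rightarrow> (('a \<Rightarrow> 'k) \<Rightarrow> ('a \<Rightarrow> 'k) \<Rightarrow> real) \<Rightarrow>
   ('k \<Rightarrow> 'y::{ab_group_add, metric_space} \<Rightarrow> 'y) \<Rightarrow> (('a \<Rightarrow> 'k) \<Rightarrow> 'y) \<Rightarrow> bool" where
  "narrow_operator M X \<rho> scl T \<longleftrightarrow>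
     continuous_linear_operator X \<rho> scl T \<and>
     (\<forall>A\<in>sets M. emeasure M A > 0 \<longrightarrow>
       (\<forall>\<epsilon>>0. \<exists>x. sign_on M A x \<and> mean_zero M x \<and> dist (T x) 0 < \<epsilon>))"

end

theory Submission
  imports Defs
begin

text \<open>
  Write \<open>m\<^sub>i A = T\<^sub>i 1\<^sub>A\<close>. Since all signed sums of values of \<open>m\<^sub>2\<close> on disjoint sets lie in a compact
  set, no disjoint sequence has values of \<open>m\<^sub>2\<close> bounded away from zero; together with narrowness this
  splits every set into finitely many blocks on whose subsets \<open>m\<^sub>2\<close> is uniformly small. Halve each
  block by narrowness of \<open>T\<^sub>1\<close>, with \<open>T\<^sub>1\<close> as small as the number of blocks requires: any choice of
  signs on the blocks then keeps \<open>T\<^sub>1\<close> small. Finitely many continuous functionals detect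
  non-small points of the compact set, each of them has bounded total variation on the blocks, and
  the blocks are small for it; hence a greedy choice of signs makes all of them, and so \<open>T\<^sub>2\<close>, small.
\<close>

section \<open>Additive functionals below a sublinear one\<close>

text \<open>The second clause asks only for an inequality, because the same inequality for
  \<open>inverse c\<close> yields equality. This keeps sublinearity easy to verify for
  infima.\<close>

definition sublinear :: "(real \<Rightarrow> 'v::ab_group_add \<Rightarrow> 'v) \<Rightarrow> ('v \<Rightarrow> real) \<Rightarrow> bool" where
  "sublinear scl p \<longleftrightarrow>
     (\<forall>x y. p (x + y) \<le> p x + p y) \<and> (\<forall>c>0. \<forall>x. p (scl c x) \<le> c * p x)"

locale real_vector_space = vector_space scl
  for scl :: "real \<Rightarrow> 'v::ab_group_add \<Rightarrow> 'v"
begin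

lemma sublinearI:
  assumes "\<And>x y. p (x + y) \<le> p x + p y" "\<And>c x. c > 0 \<Longrightarrow> p (scl c x) \<le> c * p x"
  shows "sublinear scl p"
  using assms by (simp add: sublinear_def)

lemma sublinear_add: "sublinear scl p \<Longrightarrow> p (x + y) \<le> p x + p y"
  by (simp add: sublinear_def)

lemma sublinear_scale:
  assumes p: "sublinear scl p" and c: "c > 0"
  shows "p (scl c x) = c * p x"
proof (rule antisym)
  show "p (scl c x) \<le> c * p x"
    using p c by (simp add: sublinear_def)
  have "p (scl (inverse c) (scl c x)) \<le> inverse c * p (scl c x)"
    using p c by (simp add: sublinear_def del: scale_scale)
  then show "c * p x \<le> p (scl c x)"
    using c by (simp add: field_simps)
qed

lemma sublinear_zero: "sublinear scl p \<Longrightarrow> p 0 = 0"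
  using sublinear_scale[of p 2 0] by simp

lemma sublinear_ge_minus: "sublinear scl p \<Longrightarrow> - p (- x) \<le> p x"
  using sublinear_add[of p x "- x"] by (simp add: sublinear_zero)

text \<open>Lowering \<open>q\<close> along the ray of \<open>y\<close> forces \<open>q (- y) \<le> - q y\<close>, so a minimal sublinear functional
  is odd, hence additive.\<close>

lemma sublinear_lower_along:
  assumes q: "sublinear scl q"
  shows "\<exists>r. sublinear scl r \<and> r \<le> q \<and> r (- y) \<le> - q y"
proof (intro exI conjI)
  \<comment> \<open>The infimum of \<open>F x\<close> is the lowering along the ray of
    \<open>y\<close>. Taking \<open>t = 0\<close> gives \<open>r \<le> q\<close>; taking
    \<open>t = 1\<close> at \<open>- y\<close> gives \<open>r (- y) \<le> q 0 - q y = - q y\<close>.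
    The infimum is finite because \<open>- q (- x)\<close> bounds \<open>F x\<close> from
    below.\<close>
  define F where "F x = (\<lambda>t. q (x + scl t y) - t * q y) ` {0..}" for x
  define r where "r x = Inf (F x)" for x
  have F_I: "q (x + scl t y) - t * q y \<in> F x" if "t \<ge> 0" for t x
    using that by (auto simp: F_def)
  have F_ne: "F x \<noteq> {}" for x
    by (auto simp: F_def)
  have scale_q: "q (scl t z) = t * q z" if "t \<ge> 0" for t z
    using that sublinear_scale[OF q, of t z] sublinear_zero[OF q] by (cases "t = 0") auto
  have F_bdd: "bdd_below (F x)" for x
  proof (rule bdd_belowI)
    fix z assume "z \<in> F x"
    then obtain t where t: "t \<ge> 0" "z = q (x + scl t y) - t * q y"
      by (auto simp: F_def)
    have "q (scl t y) \<le> q (x + scl t y) + q (- x)"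
      using sublinear_add[OF q, of "x + scl t y" "- x"] by simp
    then show "- q (- x) \<le> z"
      using t scale_q[of t y] by simp
  qed
  have r_le: "r x \<le> q (x + scl t y) - t * q y" if "t \<ge> 0" for t x
    unfolding r_def using F_I[OF that] F_bdd by (rule cInf_lower)
  show "sublinear scl r"
  proof (rule sublinearI)
    fix x z
    have *: "r (x + z) - a \<le> b" if ab: "a \<in> F x" "b \<in> F z" for a b
    proof -
      obtain t s where t: "t \<ge> 0" "a = q (x + scl t y) - t * q y"
        and s: "s \<ge> 0" "b = q (z + scl s y) - s * q y"
        using ab by (auto simp: F_def)
      have "r (x + z) \<le> q (x + z + scl (t + s) y) - (t + s) * q y"
        using t s by (intro r_le) simp
      also have "x + z + scl (t + s) y = (x + scl t y) + (z + scl s y)"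
        by (simp add: scale_left_distrib algebra_simps)
      also have "q \<dots> - (t + s) * q y \<le> a + b"
        using sublinear_add[OF q, of "x + scl t y" "z + scl s y"] t s
        by (simp add: algebra_simps)
      finally show ?thesis by simp
    qed
    have "r (x + z) - a \<le> r z" if "a \<in> F x" for a
      unfolding r_def[of z] using F_ne *[OF that] by (rule cInf_greatest)
    then have "r (x + z) - r z \<le> a" if "a \<in> F x" for a
      using that by force
    then have "r (x + z) - r z \<le> r x"
      unfolding r_def[of x] using F_ne by (intro cInf_greatest)
    then show "r (x + z) \<le> r x + r z" by simp
  next
    fix c :: real and x assume c: "c > 0"
    have "r (scl c x) / c \<le> a" if "a \<in> F x" for a
    proof -
      obtain t where t: "t \<ge> 0" "a = q (x + scl t y) - t * q y"
        using \<open>a \<in> F x\<close> by (auto simp: F_def)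
      have "r (scl c x) \<le> q (scl c x + scl (c * t) y) - (c * t) * q y"
        using t c by (intro r_le) simp
      also have "scl c x + scl (c * t) y = scl c (x + scl t y)"
        by (simp add: scale_right_distrib)
      also have "q \<dots> = c * q (x + scl t y)"
        using sublinear_scale[OF q c] .
      finally have "r (scl c x) \<le> c * a"
        using t by (simp add: right_diff_distrib mult.assoc)
      then show ?thesis
        using c by (simp add: field_simps)
    qed
    then have "r (scl c x) / c \<le> r x"
      unfolding r_def[of x] using F_ne by (intro cInf_greatest)
    then show "r (scl c x) \<le> c * r x"
      using c by (simp add: field_simps)
  qed
  show "r \<le> q"
    using r_le[of 0] by (auto simp: le_fun_def)
  show "r (- y) \<le> - q y"
    using r_le[of 1 "- y"] sublinear_zero[OF q] by simp
qed

text \<open>Zorn's lemma for the reversed pointwise order. The pointwise infimum of a nonempty chain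
  is finite since every member lies above \<open>- p (- x)\<close> at \<open>x\<close>, and it stays
  sublinear.\<close>

lemma ex_minimal_sublinear:
  assumes p: "sublinear scl p"
  shows "\<exists>q. sublinear scl q \<and> q \<le> p \<and> (\<forall>r. sublinear scl r \<longrightarrow> r \<le> q \<longrightarrow> r = q)"
proof -
  define S where "S = {q. sublinear scl q \<and> q \<le> p}"
  have "\<exists>q\<in>S. \<forall>r\<in>S. q \<ge> r \<longrightarrow> r = q"
  proof (rule predicate_Zorn)
    show "partial_order_on S (relation_of (\<lambda>f g. f \<ge> g) S)"
      by (rule partial_order_on_relation_ofI) auto
    fix C assume C: "C \<in> Chains (relation_of (\<lambda>f g. f \<ge> g) S)"
    then have CS: "C \<subseteq> S" and chain: "\<And>f g. f \<in> C \<Longrightarrow> g \<in> C \<Longrightarrow> f \<le> g \<or> g \<le> f"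
      by (auto simp: Chains_def relation_of_def)
    show "\<exists>u\<in>S. \<forall>a\<in>C. a \<ge> u"
    proof (cases "C = {}")
      case True
      then show ?thesis using p by (auto simp: S_def)
    next
      case False
      define u where "u x = (INF g\<in>C. g x)" for x
      have sub: "sublinear scl g" "g x \<le> p x" if "g \<in> C" for g x
        using that CS by (auto simp: S_def le_fun_def)
      have "- p (- x) \<le> g x" if "g \<in> C" for g x
        using sublinear_ge_minus[OF sub(1)[OF that], of x] sub(2)[OF that, of "- x"] by simp
      then have u_le: "u x \<le> g x" if "g \<in> C" for g x
        unfolding u_def using that by (intro cINF_lower bdd_belowI2) auto
      have "sublinear scl u"
      proof (rule sublinearI)
        fix x y
        \<comment> \<open>Subadditivity of the infimum needs one function below both
          \<open>g\<close> and \<open>h\<close>; in a chain the smaller of the two serves.\<close>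
        have *: "u (x + y) - g x \<le> h y" if g: "g \<in> C" and h: "h \<in> C" for g h
        proof -
          obtain k where k: "k \<in> C" "k \<le> g" "k \<le> h"
            using chain[OF g h] g h by auto
          have "u (x + y) \<le> k x + k y"
            using u_le[OF k(1), of "x + y"] sublinear_add[OF sub(1)[OF k(1)], of x y] by simp
          also have "\<dots> \<le> g x + h y"
            using k by (intro add_mono) (auto simp: le_fun_def)
          finally show ?thesis by simp
        qed
        have "u (x + y) - g x \<le> u y" if "g \<in> C" for g
          unfolding u_def[of y] using False *[OF that] by (rule cINF_greatest)
        then have "u (x + y) - u y \<le> g x" if "g \<in> C" for g
          using that by force
        then have "u (x + y) - u y \<le> u x"
          unfolding u_def[of x] using False by (intro cINF_greatest)
        then show "u (x + y) \<le> u x + u y" by simp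
      next
        fix c :: real and x assume c: "c > 0"
        have "u (scl c x) / c \<le> g x" if "g \<in> C" for g
          using u_le[OF that, of "scl c x"] sublinear_scale[OF sub(1)[OF that] c, of x] c
          by (simp add: field_simps)
        then have "u (scl c x) / c \<le> u x"
          unfolding u_def[of x] using False by (intro cINF_greatest)
        then show "u (scl c x) \<le> c * u x"
          using c by (simp add: field_simps)
      qed
      moreover have "u \<le> p"
        using False u_le sub(2) by (metis ex_in_conv le_funI order_trans)
      ultimately show ?thesis
        using u_le by (auto simp: S_def le_fun_def)
    qed
  qed
  then show ?thesis
    unfolding S_def by (blast intro: order_trans)
qed

text \<open>Lowering \<open>p\<close> along \<open>y\<close> first pins the value at
  \<open>y\<close>: every odd \<open>q\<close> below \<open>p'\<close> has
  \<open>q y = - q (- y) \<ge> - p' (- y) \<ge> p y\<close>. A minimal sublinear functional below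
  \<open>p'\<close> is odd, and oddness turns subadditivity into additivity.\<close>

lemma Hahn_Banach_sublinear:
  assumes p: "sublinear scl p"
  shows "\<exists>f. Modules.additive f \<and> f \<le> p \<and> f y = p y"
proof -
  obtain p' where p': "sublinear scl p'" "p' \<le> p" "p' (- y) \<le> - p y"
    using sublinear_lower_along[OF p] by blast
  obtain q where q: "sublinear scl q" "q \<le> p'"
    and min: "\<And>r. sublinear scl r \<Longrightarrow> r \<le> q \<Longrightarrow> r = q"
    using ex_minimal_sublinear[OF p'(1)] by blast
  have odd: "q (- z) = - q z" for z
  proof -
    obtain r where r: "sublinear scl r" "r \<le> q" "r (- z) \<le> - q z"
      using sublinear_lower_along[OF q(1)] by blast
    with min have "q (- z) \<le> - q z" by blast
    then show ?thesis
      using sublinear_ge_minus[OF q(1), of z] by simp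
  qed
  have "q (a + b) = q a + q b" for a b
  proof (rule antisym)
    show "q (a + b) \<le> q a + q b"
      using sublinear_add[OF q(1)] .
    show "q a + q b \<le> q (a + b)"
      using sublinear_add[OF q(1), of "- a" "- b"] odd[of "a + b"] by (simp add: odd)
  qed
  then have "Modules.additive q"
    by unfold_locales
  moreover have le: "q \<le> p"
    using q p' by simp
  moreover have "p y \<le> q y"
    using odd[of y] q(2) p'(3) by (metis le_fun_def minus_le_iff order_trans neg_le_iff_le)
  with le have "q y = p y"
    by (auto simp: le_fun_def intro: antisym)
  ultimately show ?thesis by blast
qed

end

section \<open>Metric F-spaces\<close>

locale metric_F_space = F_space scl UNIV "{0}" dist
  for scl :: "'k::real_normed_field \<Rightarrow> 'y::{ab_group_add, metric_space} \<Rightarrow> 'y"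
begin

lemma dist_add_right:
  fixes x y z :: 'y
  shows "dist (x + z) (y + z) = dist x y"
  using translation_invariant[of x y z] by simp

lemma dist_add_le:
  fixes x y a b :: 'y
  shows "dist (x + y) (a + b) \<le> dist x a + dist y b"
proof -
  have "dist (x + y) (a + b) \<le> dist (x + y) (a + y) + dist (a + y) (a + b)"
    by (rule dist_triangle)
  also have "dist (a + y) (a + b) = dist y b"
    using dist_add_right[of y a b] by (simp add: add.commute)
  finally show ?thesis
    by (simp add: dist_add_right)
qed

lemma dist_diff_zero:
  fixes x y :: 'y
  shows "dist (x - y) 0 = dist x y"
  using dist_add_right[of "x - y" y 0] by simp

lemma dist_minus_zero:
  fixes x :: 'y
  shows "dist (- x) 0 = dist x 0"
  using dist_diff_zero[of 0 x] by (simp add: dist_commute)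

lemma dist_sum_le:
  fixes f :: "'b \<Rightarrow> 'y"
  shows "dist (sum f S) 0 \<le> (\<Sum>i\<in>S. dist (f i) 0)"
proof (induction S rule: infinite_finite_induct)
  case (insert i S)
  then show ?case
    using dist_add_le[of "f i" "sum f S" 0 0] by simp
qed auto

lemma tendsto_add_F:
  fixes f g :: "'b \<Rightarrow> 'y"
  assumes f: "(f \<longlongrightarrow> a) F" and g: "(g \<longlongrightarrow> b) F"
  shows "((\<lambda>x. f x + g x) \<longlongrightarrow> a + b) F"
proof (rule metric_tendsto_imp_tendsto[where f = "\<lambda>x. dist (f x) a + dist (g x) b" and a = 0])
  show "((\<lambda>x. dist (f x) a + dist (g x) b) \<longlongrightarrow> 0) F"
    using f g by (intro tendsto_add_zero) (auto simp: tendsto_dist_iff[symmetric])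
  show "\<forall>\<^sub>F x in F. dist (f x + g x) (a + b) \<le> dist (dist (f x) a + dist (g x) b) 0"
    by (simp add: dist_add_le)
qed

lemma tendsto_scl_F:
  fixes f :: "nat \<Rightarrow> 'k"
  assumes "f \<longlonglongrightarrow> a" and "g \<longlonglongrightarrow> b"
  shows "(\<lambda>n. scl (f n) (g n)) \<longlonglongrightarrow> scl a b"
  using continuous_scl[of f a g b] assms by (simp add: tendsto_dist_iff[symmetric])

text \<open>Compact sets are bounded in the sense of the vector topology.\<close>

lemma nat_multiples_in_compact_imp_zero:
  assumes C: "compact C" and mem: "\<And>n. scl (of_nat n) b \<in> C"
  shows "b = 0"
proof -
  obtain z r where r: "strict_mono r" "((\<lambda>n. scl (of_nat n) b) \<circ> r) \<longlonglongrightarrow> z"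
    using C mem unfolding compact_def by metis
  have "(\<lambda>n. inverse (of_nat (Suc n)) :: 'k) \<longlonglongrightarrow> 0"
    using LIMSEQ_inverse_real_of_nat
    by (subst tendsto_norm_zero_iff[symmetric]) (simp add: norm_inverse del: of_nat_Suc)
  then have inv: "(\<lambda>n. inverse (of_nat n) :: 'k) \<longlonglongrightarrow> 0"
    by (rule LIMSEQ_imp_Suc)
  \<comment> \<open>Dividing the convergent multiples of \<open>b\<close> by their growing factors
    sends them to zero by joint continuity of scaling, yet the quotient is \<open>b\<close> as soon
    as \<open>r n\<close> is nonzero.\<close>
  have "(\<lambda>n. scl (inverse (of_nat (r n))) (scl (of_nat (r n)) b)) \<longlonglongrightarrow> scl 0 z"
    using tendsto_scl_F[OF LIMSEQ_subseq_LIMSEQ[OF inv r(1)] r(2)] by (simp add: o_def)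
  moreover have "\<forall>\<^sub>F n in sequentially. scl (inverse (of_nat (r n))) (scl (of_nat (r n)) b) = b"
    using eventually_gt_at_top[of 0]
  proof eventually_elim
    case (elim n)
    then have "r n \<noteq> 0"
      using seq_suble[OF r(1), of n] by simp
    then show ?case by simp
  qed
  ultimately have "(\<lambda>n. b) \<longlonglongrightarrow> 0"
    by (simp add: tendsto_cong)
  then show ?thesis
    by (simp add: LIMSEQ_const_iff)
qed

text \<open>If all terms stayed away from zero, a subsequence would converge to a nonzero
  \<open>l\<close>. Sums of \<open>n\<close> consecutive late terms of it converge to
  \<open>n\<close> times \<open>l\<close>, so the compact set would contain all these multiples of
  \<open>l\<close>, forcing \<open>l = 0\<close>.\<close>

lemma finite_sums_in_compact_imp_not_ge:
  fixes b :: "nat \<Rightarrow> 'y"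
  assumes C: "compact C" and mem: "\<And>I. finite I \<Longrightarrow> sum b I \<in> C" and \<eta>: "\<eta> > 0"
  shows "\<exists>n. dist (b n) 0 < \<eta>"
proof (rule ccontr)
  assume "\<not> ?thesis"
  then have large: "\<eta> \<le> dist (b n) 0" for n
    by (meson not_less)
  have "b n \<in> C" for n
    using mem[of "{n}"] by simp
  then obtain l r where r: "strict_mono r" "(b \<circ> r) \<longlonglongrightarrow> l"
    using C unfolding compact_def by metis
  have "scl (of_nat n) l \<in> C" for n
  proof -
    have "(\<lambda>j. \<Sum>k<n. b (r (j + k))) \<longlonglongrightarrow> scl (of_nat n) l"
    proof (induction n)
      case (Suc n)
      have "(\<lambda>j. b (r (j + n))) \<longlonglongrightarrow> l"
        using LIMSEQ_ignore_initial_segment[OF r(2), of n] by (simp add: o_def)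
      from tendsto_add_F[OF Suc this] show ?case
        by (simp add: scale_left_distrib add.commute)
    qed simp
    moreover have "(\<Sum>k<n. b (r (j + k))) \<in> C" for j
    proof -
      have "inj_on (\<lambda>k. r (j + k)) {..<n}"
        using strict_mono_eq[OF r(1)] by (auto simp: inj_on_def)
      then have "(\<Sum>k<n. b (r (j + k))) = sum b ((\<lambda>k. r (j + k)) ` {..<n})"
        by (simp add: sum.reindex)
      then show ?thesis
        using mem by simp
    qed
    ultimately show ?thesis
      by (meson closed_sequentially compact_imp_closed[OF C])
  qed
  then have "l = 0"
    using nat_multiples_in_compact_imp_zero[OF C] by blast
  have "(\<lambda>n. dist ((b \<circ> r) n) 0) \<longlonglongrightarrow> dist l 0"
    using r(2) by (intro tendsto_dist) (auto simp: o_def)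
  then have "\<eta> \<le> dist l 0"
    using large by (intro LIMSEQ_le_const) auto
  then show False
    using \<open>l = 0\<close> \<eta> by simp
qed

section \<open>Minkowski functionals of convex neighbourhoods of zero, and separation by finitely
  many functionals\<close>

sublocale real: real_vector_space "\<lambda>r. scl (of_real r)"
  by unfold_locales (simp_all add: scale_left_distrib scale_right_distrib)

text \<open>The Minkowski functional of \<open>W\<close>. Only positive dilations enter, so it can
  fail to be symmetric.\<close>

definition gauge_of :: "'y set \<Rightarrow> 'y \<Rightarrow> real" where
  "gauge_of W x = Inf {t. t > 0 \<and> scl (of_real (inverse t)) x \<in> W}"

context
  fixes W :: "'y set"
  assumes W_open: "open W" and W_0: "0 \<in> W"
    and W_convex: "\<forall>x\<in>W. \<forall>y\<in>W. \<forall>t\<in>{0..1}. scl (of_real t) x + scl (of_real (1 - t)) y \<in> W"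
begin

lemma gauge_of_le: "gauge_of W x \<le> t" if "t > 0" "scl (of_real (inverse t)) x \<in> W"
  unfolding gauge_of_def using that by (intro cInf_lower bdd_belowI[of _ 0]) auto

text \<open>A neighbourhood of zero is absorbing: the points \<open>x / (n + 1)\<close> tend to zero
  and so enter \<open>W\<close>. Without this the infimum in the gauge would be a junk
  value.\<close>

lemma gauge_of_set_nonempty: "{t. t > 0 \<and> scl (of_real (inverse t)) x \<in> W} \<noteq> {}"
proof -
  have "(\<lambda>n. of_real (inverse (of_nat (Suc n))) :: 'k) \<longlonglongrightarrow> of_real 0"
    using LIMSEQ_inverse_real_of_nat by (rule tendsto_of_real)
  then have "(\<lambda>n. scl (of_real (inverse (of_nat (Suc n)))) x) \<longlonglongrightarrow> scl (of_real 0) x"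
    by (rule tendsto_scl_F) simp
  moreover have "scl (of_real 0) x \<in> W"
    using W_0 by simp
  ultimately have "\<forall>\<^sub>F n in sequentially. scl (of_real (inverse (of_nat (Suc n)))) x \<in> W"
    using topological_tendstoD[OF _ W_open] by blast
  then obtain n where "scl (of_real (inverse (of_nat (Suc n)))) x \<in> W"
    using eventually_happens' trivial_limit_sequentially by blast
  then have "real (Suc n) \<in> {t. t > 0 \<and> scl (of_real (inverse t)) x \<in> W}"
    by simp
  then show ?thesis by blast
qed

lemma gauge_of_less_one: "x \<in> W" if less: "gauge_of W x < 1"
proof -
  obtain t where t: "t > 0" "scl (of_real (inverse t)) x \<in> W" "t < 1"
    using cInf_lessD[OF gauge_of_set_nonempty less[unfolded gauge_of_def]] by auto
  \<comment> \<open>For \<open>t < 1\<close> the point \<open>x\<close> is the convex combination of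
    \<open>x / t\<close> and zero with weights \<open>t\<close> and \<open>1 - t\<close>.\<close>
  then show ?thesis
    using W_convex[rule_format, OF t(2) W_0, of t] by simp
qed

lemma sublinear_gauge_of: "sublinear (\<lambda>r. scl (of_real r)) (gauge_of W)"
proof (rule real.sublinearI)
  fix x y
  have *: "gauge_of W (x + y) \<le> t + s"
    if t: "t > 0" "scl (of_real (inverse t)) x \<in> W" and s: "s > 0" "scl (of_real (inverse s)) y \<in> W"
    for t s
  proof (rule gauge_of_le)
    \<comment> \<open>With weights \<open>t / (t + s)\<close> and \<open>s / (t + s)\<close>, the
      convex combination of \<open>x / t\<close> and \<open>y / s\<close> is
      \<open>(x + y) / (t + s)\<close>.\<close>
    have "t / (t + s) * inverse t = inverse (t + s)" "(1 - t / (t + s)) * inverse s = inverse (t + s)"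
      using t s by (simp_all add: field_simps)
    then have "scl (of_real (t / (t + s))) (scl (of_real (inverse t)) x) +
        scl (of_real (1 - t / (t + s))) (scl (of_real (inverse s)) y) = scl (of_real (inverse (t + s))) (x + y)"
      by (simp only: scale_scale of_real_mult[symmetric] scale_right_distrib)
    then show "scl (of_real (inverse (t + s))) (x + y) \<in> W"
      using W_convex[rule_format, OF t(2) s(2), of "t / (t + s)"] t s by simp
  qed (use t s in simp)
  have "gauge_of W (x + y) - t \<le> gauge_of W y"
    if "t > 0" "scl (of_real (inverse t)) x \<in> W" for t
    unfolding gauge_of_def[of W y] using *[OF that]
    by (intro cInf_greatest gauge_of_set_nonempty) force
  then have "gauge_of W (x + y) - gauge_of W y \<le> gauge_of W x"
    unfolding gauge_of_def[of W x]
    by (intro cInf_greatest gauge_of_set_nonempty) force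
  then show "gauge_of W (x + y) \<le> gauge_of W x + gauge_of W y" by simp
next
  fix c :: real and x assume c: "c > 0"
  have "gauge_of W (scl (of_real c) x) / c \<le> t"
    if t: "t > 0" "scl (of_real (inverse t)) x \<in> W" for t
  proof -
    have "gauge_of W (scl (of_real c) x) \<le> c * t"
    proof (rule gauge_of_le)
      have "inverse (c * t) * c = inverse t"
        using c by (simp add: field_simps)
      then show "scl (of_real (inverse (c * t))) (scl (of_real c) x) \<in> W"
        using t by (simp only: scale_scale of_real_mult[symmetric])
    qed (use c t in simp)
    then show ?thesis
      using c by (simp add: field_simps)
  qed
  then have "gauge_of W (scl (of_real c) x) / c \<le> gauge_of W x"
    unfolding gauge_of_def[of W x]
    by (intro cInf_greatest gauge_of_set_nonempty) force
  then show "gauge_of W (scl (of_real c) x) \<le> c * gauge_of W x"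
    using c by (simp add: field_simps)
qed

lemma eventually_gauge_of_diff_less:
  assumes e: "e > 0" and r: "r \<longlonglongrightarrow> (z::'y)"
  shows "\<forall>\<^sub>F n in sequentially. gauge_of W (r n - z) < e"
proof -
  have "(\<lambda>n. r n + - z) \<longlonglongrightarrow> z + - z"
    using r by (intro tendsto_add_F tendsto_const)
  \<comment> \<open>Dilating by \<open>2 / e\<close> puts the differences into \<open>W\<close>
    eventually, which bounds the gauge by \<open>e / 2\<close>; the half restores a strict
    inequality.\<close>
  then have "(\<lambda>n. scl (of_real (inverse (e / 2))) (r n - z)) \<longlonglongrightarrow> scl (of_real (inverse (e / 2))) 0"
    by (intro tendsto_scl_F tendsto_const) simp
  then have "\<forall>\<^sub>F n in sequentially. scl (of_real (inverse (e / 2))) (r n - z) \<in> W"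
    using W_open W_0 by (auto dest!: topological_tendstoD[where S = W])
  then show ?thesis
  proof eventually_elim
    case (elim n)
    then have "gauge_of W (r n - z) \<le> e / 2"
      using e by (intro gauge_of_le) auto
    with e show ?case by simp
  qed
qed

text \<open>The gauge bounds \<open>f\<close> only from above, and \<open>W\<close> may be
  asymmetric. The lower bound comes from applying the same estimate to the negated sequence.\<close>

lemma continuous_on_additive_le_gauge_of:
  assumes f: "Modules.additive f" and le: "f \<le> gauge_of W"
  shows "continuous_on UNIV f"
proof (rule continuous_on_sequentiallyI)
  fix u :: "nat \<Rightarrow> 'y" and z assume u: "u \<longlonglongrightarrow> z"
  show "(\<lambda>n. f (u n)) \<longlonglongrightarrow> f z"
  proof (rule LIMSEQ_I)
    fix e :: real assume e: "e > 0"
    have "(\<lambda>n. scl (of_real (-1)) (u n)) \<longlonglongrightarrow> scl (of_real (-1)) z"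
      using u by (intro tendsto_scl_F tendsto_const)
    then have "(\<lambda>n. - u n) \<longlonglongrightarrow> - z"
      by simp
    from eventually_gauge_of_diff_less[OF e u] eventually_gauge_of_diff_less[OF e this]
    have "\<forall>\<^sub>F n in sequentially. norm (f (u n) - f z) < e"
    proof eventually_elim
      case (elim n)
      have less: "f (u n - z) < e" "f (- u n - - z) < e"
        using elim le by (metis le_funD le_less_trans)+
      have "f (u n - z) = f (u n) - f z" "f (- u n - - z) = f z - f (u n)"
        by (simp_all add: additive.diff[OF f] additive.minus[OF f] del: minus_diff_minus diff_minus_eq_add)
      then show ?case
        using less by (simp add: abs_less_iff del: minus_diff_minus diff_minus_eq_add)
    qed
    then show "\<exists>N. \<forall>n\<ge>N. norm (f (u n) - f z) < e"
      by (simp add: eventually_sequentially)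
  qed
qed

end

text \<open>Points outside the ball have gauge at least 1, and Hahn-Banach supplies a functional
  attaining the gauge there. The open sets where such functionals exceed \<open>1 / 2\<close>
  therefore cover the compact set \<open>C - ball 0 \<epsilon>\<close>, and a finite subcover gives
  the family.\<close>

lemma finite_functionals_detect_large:
  fixes C :: "'y set"
  assumes lc: "locally_convex scl" and C: "compact C" and \<epsilon>: "\<epsilon> > 0"
  shows "\<exists>\<F> :: ('y \<Rightarrow> real) set. finite \<F> \<and> (\<forall>f\<in>\<F>. Modules.additive f \<and> continuous_on UNIV f) \<and>
    (\<forall>y\<in>C. (\<forall>f\<in>\<F>. \<bar>f y\<bar> \<le> 1 / 2) \<longrightarrow> dist y 0 < \<epsilon>)"
proof -
  obtain W where W: "open W" "0 \<in> W" "W \<subseteq> ball 0 \<epsilon>"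
    and W_convex: "\<forall>x\<in>W. \<forall>y\<in>W. \<forall>t\<in>{0..1}. scl (of_real t) x + scl (of_real (1 - t)) y \<in> W"
    using lc[unfolded locally_convex_def, rule_format, of "ball 0 \<epsilon>"] \<epsilon> by auto
  note gauge = sublinear_gauge_of[OF W(1,2) W_convex]
    continuous_on_additive_le_gauge_of[OF W(1,2) W_convex] gauge_of_less_one[OF W(1,2) W_convex]
  define \<G> where "\<G> = {f. Modules.additive f \<and> continuous_on UNIV (f::'y \<Rightarrow> real)}"
  define D where "D = C - ball 0 \<epsilon>"
  have "\<exists>f\<in>\<G>. 1 / 2 < f y" if y: "y \<in> D" for y :: 'y
  proof -
    obtain f where f: "Modules.additive f" "f \<le> gauge_of W" "f y = gauge_of W y"
      using real.Hahn_Banach_sublinear[OF gauge(1)] by blast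
    have "1 \<le> gauge_of W y"
      using gauge(3)[of y] y W(3) by (force simp: D_def)
    with f gauge(2)[OF f(1,2)] show ?thesis
      by (intro bexI[of _ f]) (auto simp: \<G>_def)
  qed
  then have "D \<subseteq> (\<Union>f\<in>\<G>. {y. 1 / 2 < f y})"
    by blast
  moreover have "compact D"
    unfolding D_def using C by (intro compact_diff) auto
  moreover have "open {y. 1 / 2 < f y}" if "f \<in> \<G>" for f
    using that by (intro open_Collect_less continuous_on_const) (auto simp: \<G>_def)
  ultimately obtain \<F> where \<F>: "\<F> \<subseteq> \<G>" "finite \<F>" "D \<subseteq> (\<Union>f\<in>\<F>. {y. 1 / 2 < f y})"
    by (metis compactE_image)
  show ?thesis
  proof (intro exI[of _ \<F>] conjI ballI impI)
    fix y assume y: "y \<in> C" "\<forall>f\<in>\<F>. \<bar>f y\<bar> \<le> 1 / 2"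
    with \<F>(3) have "y \<notin> D"
      by fastforce
    with y show "dist y 0 < \<epsilon>"
      by (simp add: D_def dist_commute)
  qed (use \<F> in \<open>auto simp: \<G>_def\<close>)
qed

end

text \<open>Vectors in Euclidean space are added one at a time, each with the sign that makes its
  inner product with the current partial sum nonpositive. The squared norm then grows by at most
  that of the new vector.\<close>

lemma ex_signs_sum_squares_le:
  fixes v :: "'b \<Rightarrow> 'i \<Rightarrow> real"
  assumes "finite P"
  shows "\<exists>\<theta>. (\<forall>B. \<theta> B \<in> {1, -1}) \<and>
    (\<Sum>i\<in>I. (\<Sum>B\<in>P. \<theta> B * v B i)\<^sup>2) \<le> (\<Sum>B\<in>P. \<Sum>i\<in>I. (v B i)\<^sup>2)"
  using assms
proof induction
  case empty
  show ?case by (intro exI[of _ "\<lambda>_. 1"]) simp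
next
  case (insert B P)
  then obtain \<theta> where \<theta>: "\<forall>B. \<theta> B \<in> {1, -1::real}"
    "(\<Sum>i\<in>I. (\<Sum>B\<in>P. \<theta> B * v B i)\<^sup>2) \<le> (\<Sum>B\<in>P. \<Sum>i\<in>I. (v B i)\<^sup>2)"
    by blast
  define s where "s i = (\<Sum>B\<in>P. \<theta> B * v B i)" for i
  define c where "c = (\<Sum>i\<in>I. s i * v B i)"
  define t :: real where "t = (if c \<le> 0 then 1 else - 1)"
  have t: "t\<^sup>2 = 1" "t * c \<le> 0"
    by (auto simp: t_def)
  have "(\<Sum>C\<in>insert B P. (\<theta>(B := t)) C * v C i) = t * v B i + s i" for i
  proof -
    have "(\<Sum>C\<in>P. (\<theta>(B := t)) C * v C i) = s i"
      unfolding s_def using insert by (intro sum.cong) auto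
    then show ?thesis
      using insert by simp
  qed
  then have "(\<Sum>i\<in>I. (\<Sum>C\<in>insert B P. (\<theta>(B := t)) C * v C i)\<^sup>2) = (\<Sum>i\<in>I. (t * v B i + s i)\<^sup>2)"
    by simp
  also have "\<dots> = (\<Sum>i\<in>I. (v B i)\<^sup>2) + 2 * (t * c) + (\<Sum>i\<in>I. (s i)\<^sup>2)"
    using t(1) by (simp add: power2_sum power_mult_distrib sum.distrib c_def sum_distrib_left algebra_simps)
  also have "\<dots> \<le> (\<Sum>C\<in>insert B P. \<Sum>i\<in>I. (v C i)\<^sup>2)"
    using t(2) \<theta>(2) insert by (simp add: s_def)
  finally show ?case
    using \<theta>(1) by (intro exI[of _ "\<theta>(B := t)"]) (auto simp: t_def)
qed

section \<open>Vector charges\<close>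

text \<open>The set-function form of narrowness: \<open>C\<close> and \<open>A - C\<close> are the
  positive and negative parts of the sign, and equal measure expresses mean zero. Null sets are
  included so that later arguments need no case distinction.\<close>

definition narrow_charge :: "'a measure \<Rightarrow> ('a set \<Rightarrow> 'y::metric_space) \<Rightarrow> bool" where
  "narrow_charge M m \<longleftrightarrow> (\<forall>A\<in>sets M. \<forall>\<epsilon>>0. \<exists>C\<in>sets M.
     C \<subseteq> A \<and> measure M C = measure M (A - C) \<and> dist (m C) (m (A - C)) < \<epsilon>)"

text \<open>The positive part of a sign assembled blockwise: on \<open>B\<close> it is the sign that
  is 1 on \<open>C B\<close> and -1 on the rest of \<open>B\<close>, or its negative, according to
  \<open>s B\<close>.\<close>

definition select :: "'a set set \<Rightarrow> ('a set \<Rightarrow> 'a set) \<Rightarrow> ('a set \<Rightarrow> bool) \<Rightarrow> 'a set" where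
  "select \<P> C s = (\<Union>B\<in>\<P>. if s B then C B else B - C B)"

lemma Union_Diff_select:
  assumes "disjoint \<P>" "\<And>B. B \<in> \<P> \<Longrightarrow> C B \<subseteq> B"
  shows "\<Union>\<P> - select \<P> C s = select \<P> C (\<lambda>B. \<not> s B)"
proof (intro set_eqI iffI)
  fix t assume "t \<in> \<Union>\<P> - select \<P> C s"
  then show "t \<in> select \<P> C (\<lambda>B. \<not> s B)"
    by (fastforce simp: select_def split: if_splits)
next
  fix t assume "t \<in> select \<P> C (\<lambda>B. \<not> s B)"
  then obtain B where B: "B \<in> \<P>" "t \<in> (if s B then B - C B else C B)"
    by (auto simp: select_def split: if_splits)
  have tB: "t \<in> B"
    using B assms(2)[OF B(1)] by (auto split: if_splits)
  have "t \<notin> select \<P> C s"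
  proof
    assume "t \<in> select \<P> C s"
    then obtain B' where B': "B' \<in> \<P>" "t \<in> (if s B' then C B' else B' - C B')"
      by (auto simp: select_def)
    then have "t \<in> B'"
      using assms(2)[OF B'(1)] by (auto split: if_splits)
    then have "B' = B"
      using tB assms(1) B(1) B'(1) by (auto simp: disjoint_def)
    then show False
      using B B' by (auto split: if_splits)
  qed
  then show "t \<in> \<Union>\<P> - select \<P> C s"
    using B(1) tB by blast
qed

lemma disjoint_family_on_select:
  assumes "disjoint \<P>" "\<And>B. B \<in> \<P> \<Longrightarrow> C B \<subseteq> B"
  shows "disjoint_family_on (\<lambda>B. if s B then C B else B - C B) \<P>"
  unfolding disjoint_family_on_def
proof (intro ballI impI)
  fix B B' assume *: "B \<in> \<P>" "B' \<in> \<P>" "B \<noteq> B'"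
  then have "B \<inter> B' = {}"
    using assms(1) by (auto simp: disjoint_def)
  then show "(if s B then C B else B - C B) \<inter> (if s B' then C B' else B' - C B') = {}"
    using assms(2)[OF *(1)] assms(2)[OF *(2)] by auto
qed

text \<open>Both halves of a block have the same measure, so the total does not depend on
  \<open>s\<close>. As the complement of a selection is the opposite selection, it has the same
  measure too.\<close>

lemma measure_select:
  assumes "finite_measure M" "finite \<P>" "\<P> \<subseteq> sets M" "disjoint \<P>"
    and C: "\<And>B. B \<in> \<P> \<Longrightarrow> C B \<in> sets M" "\<And>B. B \<in> \<P> \<Longrightarrow> C B \<subseteq> B"
    and half: "\<And>B. B \<in> \<P> \<Longrightarrow> measure M (C B) = measure M (B - C B)"
  shows "measure M (select \<P> C s) = (\<Sum>B\<in>\<P>. measure M (C B))"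
proof -
  have "measure M (select \<P> C s) = (\<Sum>B\<in>\<P>. measure M (if s B then C B else B - C B))"
    unfolding select_def
    using assms(2,3) C(1)
    by (intro finite_measure.finite_measure_finite_Union[OF assms(1)]
        disjoint_family_on_select[OF assms(4) C(2)]) auto
  also have "\<dots> = (\<Sum>B\<in>\<P>. measure M (C B))"
    by (intro sum.cong) (auto simp: half)
  finally show ?thesis .
qed

locale vector_charge = metric_F_space scl
  for scl :: "'k::real_normed_field \<Rightarrow> 'y::{ab_group_add, metric_space} \<Rightarrow> 'y" +
  fixes M :: "'a measure" and m :: "'a set \<Rightarrow> 'y"
  assumes charge_Un: "A \<in> sets M \<Longrightarrow> B \<in> sets M \<Longrightarrow> A \<inter> B = {} \<Longrightarrow> m (A \<union> B) = m A + m B"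
begin

lemma charge_empty: "m {} = 0"
  using charge_Un[of "{}" "{}"] by simp

lemma charge_Diff: "A \<in> sets M \<Longrightarrow> B \<in> sets M \<Longrightarrow> B \<subseteq> A \<Longrightarrow> m A = m B + m (A - B)"
  using charge_Un[of B "A - B"] by (auto simp: Un_absorb1)

lemma charge_UN:
  assumes "finite I" "\<And>i. i \<in> I \<Longrightarrow> D i \<in> sets M" "disjoint_family_on D I"
  shows "m (\<Union>i\<in>I. D i) = (\<Sum>i\<in>I. m (D i))"
  using assms
proof (induction I)
  case empty
  show ?case by (simp add: charge_empty)
next
  case (insert i I)
  have "D i \<inter> (\<Union>j\<in>I. D j) = {}"
    using insert by (auto simp: disjoint_family_on_def)
  then have "m (D i \<union> (\<Union>j\<in>I. D j)) = m (D i) + m (\<Union>j\<in>I. D j)"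
    using insert by (intro charge_Un sets.finite_UN) auto
  then show ?case
    using insert by (simp add: disjoint_family_on_mono[OF subset_insertI])
qed

lemma select_in_sets:
  assumes "finite \<P>" "\<P> \<subseteq> sets M" "\<And>B. B \<in> \<P> \<Longrightarrow> C B \<in> sets M"
  shows "select \<P> C s \<in> sets M"
  unfolding select_def using assms by (intro sets.finite_UN) auto

lemma charge_select:
  assumes "finite \<P>" "\<P> \<subseteq> sets M" "disjoint \<P>"
    and C: "\<And>B. B \<in> \<P> \<Longrightarrow> C B \<in> sets M" "\<And>B. B \<in> \<P> \<Longrightarrow> C B \<subseteq> B"
  shows "m (select \<P> C s) - m (\<Union>\<P> - select \<P> C s) =
    (\<Sum>B\<in>\<P>. if s B then m (C B) - m (B - C B) else - (m (C B) - m (B - C B)))"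
proof -
  have sel: "m (select \<P> C s) = (\<Sum>B\<in>\<P>. m (if s B then C B else B - C B))" for s
    unfolding select_def using assms
    by (intro charge_UN disjoint_family_on_select) auto
  have "\<Union>\<P> - select \<P> C s = select \<P> C (\<lambda>B. \<not> s B)"
    using assms(3) C(2) by (rule Union_Diff_select)
  then have "m (select \<P> C s) - m (\<Union>\<P> - select \<P> C s) =
      (\<Sum>B\<in>\<P>. m (if s B then C B else B - C B) - m (if \<not> s B then C B else B - C B))"
    by (simp only: sel sum_subtractf)
  also have "\<dots> = (\<Sum>B\<in>\<P>. if s B then m (C B) - m (B - C B) else - (m (C B) - m (B - C B)))"
    by (intro sum.cong) auto
  finally show ?thesis .
qed

text \<open>Demanding smallness of every measurable subset lets the bound pass to halves that are
  chosen only after the blocks are fixed.\<close>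

definition small_on :: "real \<Rightarrow> 'a set \<Rightarrow> bool" where
  "small_on \<delta> B \<longleftrightarrow> (\<forall>C\<in>sets M. C \<subseteq> B \<longrightarrow> dist (m C) 0 < \<delta>)"

definition splits_small :: "real \<Rightarrow> 'a set \<Rightarrow> bool" where
  "splits_small \<delta> A \<longleftrightarrow> (\<exists>\<P>. finite \<P> \<and> \<P> \<subseteq> sets M \<and> disjoint \<P> \<and> \<Union>\<P> = A \<and>
     (\<forall>B\<in>\<P>. small_on \<delta> B))"

lemma small_on_imp_splits_small:
  assumes "A \<in> sets M" "small_on \<delta> A"
  shows "splits_small \<delta> A"
  unfolding splits_small_def using assms by (intro exI[of _ "{A}"]) (auto simp: disjoint_def)

lemma splits_small_Un:
  assumes "splits_small \<delta> A" "splits_small \<delta> B" "A \<inter> B = {}"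
  shows "splits_small \<delta> (A \<union> B)"
proof -
  obtain \<P> \<Q> where
    "finite \<P>" "\<P> \<subseteq> sets M" "disjoint \<P>" "\<Union>\<P> = A" "\<forall>B\<in>\<P>. small_on \<delta> B"
    "finite \<Q>" "\<Q> \<subseteq> sets M" "disjoint \<Q>" "\<Union>\<Q> = B" "\<forall>B\<in>\<Q>. small_on \<delta> B"
    using assms(1,2) unfolding splits_small_def by metis
  with assms(3) show ?thesis
    unfolding splits_small_def
    by (intro exI[of _ "\<P> \<union> \<Q>"]) (auto intro!: disjoint_union)
qed

end

section \<open>Charges whose differences on disjoint sets lie in a compact set\<close>

locale compact_vector_charge = vector_charge scl M m
  for scl :: "'k::real_normed_field \<Rightarrow> 'y::{ab_group_add, metric_space} \<Rightarrow> 'y"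
    and M :: "'a measure" and m :: "'a set \<Rightarrow> 'y" +
  fixes K :: "'y set"
  assumes compact_K: "compact K"
    and charge_diff_in_K: "C \<in> sets M \<Longrightarrow> D \<in> sets M \<Longrightarrow> C \<inter> D = {} \<Longrightarrow> m C - m D \<in> K"
begin

lemma charge_disjoint_family_not_ge:
  assumes "range B \<subseteq> sets M" "disjoint_family B" "\<eta> > 0"
  shows "\<exists>n::nat. dist (m (B n)) 0 < \<eta>"
proof (rule finite_sums_in_compact_imp_not_ge[OF compact_K _ assms(3)])
  fix I :: "nat set" assume I: "finite I"
  have "m (\<Union>i\<in>I. B i) = (\<Sum>i\<in>I. m (B i))"
    using assms I by (intro charge_UN) (auto simp: disjoint_family_on_def)
  moreover have "m (\<Union>i\<in>I. B i) - m {} \<in> K"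
    using assms I by (intro charge_diff_in_K sets.finite_UN) auto
  ultimately show "(\<Sum>i\<in>I. m (B i)) \<in> K"
    by (simp add: charge_empty)
qed

text \<open>Otherwise one could descend within \<open>P\<close> forever, each step leaving behind a
  set of charge at least \<open>\<eta>\<close>. These leftovers are disjoint, contradicting the
  previous lemma. Below, \<open>P\<close> is the property of being measurable without a small
  splitting.\<close>

lemma ex_small_on_differences:
  assumes A: "P A" and P: "\<And>A. P A \<Longrightarrow> A \<in> sets M" and \<eta>: "\<eta> > 0"
  shows "\<exists>A'. P A' \<and> (\<forall>C. P C \<longrightarrow> C \<subseteq> A' \<longrightarrow> small_on \<eta> (A' - C))"
proof (rule ccontr)
  assume "\<not> ?thesis"
  then have step: "\<exists>C. P C \<and> (C \<subseteq> A' \<and> (\<exists>B\<in>sets M. B \<subseteq> A' - C \<and> \<eta> \<le> dist (m B) 0))"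
    if "P A'" for A'
    using that unfolding small_on_def by (meson not_less)
  have "\<exists>S. \<forall>n. P (S n) \<and> (S (Suc n) \<subseteq> S n \<and>
      (\<exists>B\<in>sets M. B \<subseteq> S n - S (Suc n) \<and> \<eta> \<le> dist (m B) 0))"
    by (rule dependent_nat_choice) (use A step in blast)+
  then obtain S where S: "\<And>n. S (Suc n) \<subseteq> S n"
    "\<And>n. \<exists>B\<in>sets M. B \<subseteq> S n - S (Suc n) \<and> \<eta> \<le> dist (m B) 0"
    by blast
  then obtain B where B: "\<And>n. B n \<in> sets M" "\<And>n. B n \<subseteq> S n - S (Suc n)"
    "\<And>n. \<eta> \<le> dist (m (B n)) 0"
    by metis
  have "decseq S"
    using S(1) by (rule decseq_SucI)
  have "B i \<inter> B j = {}" if "i < j" for i j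
  proof -
    have "S j \<subseteq> S (Suc i)"
      using decseqD[OF \<open>decseq S\<close>, of "Suc i" j] that by simp
    then show ?thesis
      using B(2)[of i] B(2)[of j] by blast
  qed
  then have "disjoint_family B"
    unfolding disjoint_family_on_def by (metis Int_commute linorder_neqE_nat)
  then show False
    using charge_disjoint_family_not_ge[of B \<eta>] B(1,3) \<eta> by (force simp: not_le[symmetric])
qed

text \<open>Some set \<open>A'\<close> without small splitting is such that every subset that leaves a remainder without
  small splitting carries little charge; halving \<open>A'\<close> by narrowness then makes \<open>m\<close> small on all of \<open>A'\<close>.\<close>

lemma narrow_imp_splits_small:
  assumes narrow: "narrow_charge M m" and A: "A \<in> sets M" and \<delta>: "\<delta> > 0"
  shows "splits_small \<delta> A"
proof (rule ccontr)
  assume bad_A: "\<not> splits_small \<delta> A"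
  define bad where "bad A \<longleftrightarrow> A \<in> sets M \<and> \<not> splits_small \<delta> A" for A
  \<comment> \<open>The budget: \<open>m A'\<close> will cost less than \<open>3 * \<eta>\<close>,
    and passing from \<open>A'\<close> to a bad subset costs one more \<open>\<eta>\<close>.\<close>
  define \<eta> where "\<eta> = \<delta> / 4"
  have \<eta>: "\<eta> > 0" "\<delta> = 4 * \<eta>"
    using \<delta> by (auto simp: \<eta>_def)
  obtain A' where A': "bad A'" and diff: "\<And>C. bad C \<Longrightarrow> C \<subseteq> A' \<Longrightarrow> small_on \<eta> (A' - C)"
    using ex_small_on_differences[of bad A \<eta>] bad_A A \<eta> by (auto simp: bad_def)
  have A'_sets: "A' \<in> sets M"
    using A' by (simp add: bad_def)
  \<comment> \<open>Small splittings of \<open>C\<close> and of its complement would combine to one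
    of \<open>A'\<close>.\<close>
  have bad_cases: "bad C \<or> bad (A' - C)" if C: "C \<in> sets M" "C \<subseteq> A'" for C
  proof (rule ccontr)
    assume "\<not> ?thesis"
    then have "splits_small \<delta> (C \<union> (A' - C))"
      using C A'_sets by (intro splits_small_Un) (auto simp: bad_def)
    with C A' show False
      by (simp add: bad_def Un_absorb1)
  qed
  have bad_diff: "dist (m (A' - C)) 0 < \<eta>" if "bad C" "C \<subseteq> A'" for C
    using diff[OF that] that A'_sets by (auto simp: small_on_def bad_def)
  \<comment> \<open>A bad half leaves a complement of charge below \<open>\<eta>\<close>. The bad
    half itself is within \<open>\<eta>\<close> of that charge, so both together stay below
    \<open>3 * \<eta>\<close>.\<close>
  have halves: "dist (m A') 0 < 3 * \<eta>"
    if C: "C \<in> sets M" "C \<subseteq> A'" "bad C" "dist (m C) (m (A' - C)) < \<eta>" for C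
  proof -
    have "dist (m C) 0 < 2 * \<eta>"
      using dist_triangle[of "m C" 0 "m (A' - C)"] bad_diff[OF C(3,2)] C(4) by simp
    moreover have "dist (m A') 0 \<le> dist (m C) 0 + dist (m (A' - C)) 0"
      using dist_add_le[of "m C" "m (A' - C)" 0 0] charge_Diff[OF A'_sets C(1,2)] by simp
    ultimately show ?thesis
      using bad_diff[OF C(3,2)] by simp
  qed
  obtain C where C: "C \<in> sets M" "C \<subseteq> A'" "dist (m C) (m (A' - C)) < \<eta>"
    using narrow A'_sets \<eta>(1) unfolding narrow_charge_def by blast
  have m_A': "dist (m A') 0 < 3 * \<eta>"
  proof (cases "bad C")
    case True
    with C show ?thesis by (intro halves) auto
  next
    case False
    then have "bad (A' - C)"
      using bad_cases C by blast
    moreover have "A' - (A' - C) = C"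
      using C by blast
    ultimately show ?thesis
      using C A'_sets by (intro halves[of "A' - C"]) (auto simp: dist_commute)
  qed
  have "small_on \<delta> A'"
    unfolding small_on_def
  proof (intro ballI impI)
    fix F assume F: "F \<in> sets M" "F \<subseteq> A'"
    show "dist (m F) 0 < \<delta>"
    proof (cases "bad F")
      case True
      have "m F = m A' + - m (A' - F)"
        using charge_Diff[OF A'_sets F] by simp
      then have "dist (m F) 0 \<le> dist (m A') 0 + dist (m (A' - F)) 0"
        using dist_add_le[of "m A'" "- m (A' - F)" 0 0] by (simp add: dist_minus_zero)
      then show ?thesis
        using bad_diff[OF True F(2)] m_A' \<eta>(2) by simp
    next
      case False
      then have "bad (A' - F)"
        using bad_cases F by blast
      \<comment> \<open>Here the complement of \<open>F\<close> is bad, so \<open>F\<close> is what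
        it leaves of \<open>A'\<close> and is small.\<close>
      from diff[OF this] have "small_on \<eta> F"
        using F by (simp add: double_diff)
      then have "dist (m F) 0 < \<eta>"
        using F by (auto simp: small_on_def)
      then show ?thesis
        using \<eta> by simp
    qed
  qed
  then have "splits_small \<delta> A'"
    using A'_sets by (rule small_on_imp_splits_small[rotated])
  then show False
    using A' by (simp add: bad_def)
qed

text \<open>Choosing on each block the sign of \<open>f\<close> turns the sum of absolute values
  into the value of \<open>f\<close> at a single point of \<open>K\<close>. The bound is thus
  independent of the number of blocks.\<close>

lemma sum_abs_functional_bounded:
  fixes f :: "'y \<Rightarrow> real"
  assumes f: "Modules.additive f" and bound: "\<And>y. y \<in> K \<Longrightarrow> \<bar>f y\<bar> \<le> b"
    and \<P>: "finite \<P>" "\<P> \<subseteq> sets M" "disjoint \<P>"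
    and C: "\<And>B. B \<in> \<P> \<Longrightarrow> C B \<in> sets M" "\<And>B. B \<in> \<P> \<Longrightarrow> C B \<subseteq> B"
  shows "(\<Sum>B\<in>\<P>. \<bar>f (m (C B) - m (B - C B))\<bar>) \<le> b"
proof -
  define v where "v B = m (C B) - m (B - C B)" for B
  define s where "s B \<longleftrightarrow> 0 \<le> f (v B)" for B
  define D where "D = select \<P> C s"
  have D: "D \<in> sets M" "\<Union>\<P> - D \<in> sets M"
    unfolding D_def using \<P> C by (auto intro!: select_in_sets sets.Diff sets.finite_Union)
  have "m D - m (\<Union>\<P> - D) = (\<Sum>B\<in>\<P>. if s B then v B else - v B)"
    unfolding D_def v_def using \<P> C by (rule charge_select)
  then have "f (m D - m (\<Union>\<P> - D)) = (\<Sum>B\<in>\<P>. f (if s B then v B else - v B))"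
    by (simp only: additive.sum[OF f])
  also have "\<dots> = (\<Sum>B\<in>\<P>. \<bar>f (v B)\<bar>)"
    by (intro sum.cong) (auto simp: s_def additive.minus[OF f])
  finally show ?thesis
    using bound[OF charge_diff_in_K[OF D]] unfolding v_def by force
qed

lemma narrow_charge_add:
  assumes lc: "locally_convex scl" and M: "finite_measure M"
    and charge': "vector_charge scl M m'" and narrow': "narrow_charge M m'"
    and narrow: "narrow_charge M m"
  shows "narrow_charge M (\<lambda>A. m' A + m A)"
  unfolding narrow_charge_def
proof (intro ballI allI impI)
  fix A and \<epsilon> :: real assume A: "A \<in> sets M" and \<epsilon>: "\<epsilon> > 0"
  interpret m': vector_charge scl M m' by fact
  obtain \<F> :: "('y \<Rightarrow> real) set" where \<F>: "finite \<F>"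
    and add: "\<And>f. f \<in> \<F> \<Longrightarrow> Modules.additive f" and cont: "\<And>f. f \<in> \<F> \<Longrightarrow> continuous_on UNIV f"
    and detect: "\<And>y. y \<in> K \<Longrightarrow> (\<forall>f\<in>\<F>. \<bar>f y\<bar> \<le> 1 / 2) \<Longrightarrow> dist y 0 < \<epsilon> / 2"
    using finite_functionals_detect_large[OF lc compact_K, of "\<epsilon> / 2"] \<epsilon> by auto
  have "\<exists>b. \<forall>y\<in>K. \<bar>f y\<bar> \<le> b" if "f \<in> \<F>" for f
  proof -
    have "bounded (f ` K)"
      using cont[OF that] compact_K
      by (blast intro: compact_imp_bounded compact_continuous_image continuous_on_subset)
    then show ?thesis
      by (auto simp: bounded_iff)
  qed
  then obtain b where b: "\<And>f y. f \<in> \<F> \<Longrightarrow> y \<in> K \<Longrightarrow> \<bar>f y\<bar> \<le> b f"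
    by metis
  have "0 \<in> K"
    using charge_diff_in_K[of "{}" "{}"] by simp
  then have b_nonneg: "0 \<le> b f" if "f \<in> \<F>" for f
    using b[OF that] by force
  \<comment> \<open>Chosen so that \<open>\<gamma> * sum b \<F>\<close> is at most
    \<open>1 / 4\<close>, the square of the detection threshold; the summand 1 keeps the denominator
    positive.\<close>
  define \<gamma> where "\<gamma> = 1 / (4 * (1 + sum b \<F>))"
  have sum_b: "0 \<le> sum b \<F>"
    using b_nonneg by (rule sum_nonneg)
  then have \<gamma>: "\<gamma> > 0" "\<gamma> * sum b \<F> \<le> 1 / 4"
    by (auto simp: \<gamma>_def field_simps)
  have "\<forall>\<^sub>F y in nhds 0. \<forall>f\<in>\<F>. \<bar>f y\<bar> < \<gamma>"
  proof (intro eventually_ball_finite[OF \<F>] ballI)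
    fix f assume f: "f \<in> \<F>"
    have "(f \<longlongrightarrow> f 0) (nhds 0)"
      using cont[OF f] by (simp add: continuous_on_eq_continuous_at isCont_def tendsto_at_iff_tendsto_nhds)
    from tendstoD[OF this \<gamma>(1)] show "\<forall>\<^sub>F y in nhds 0. \<bar>f y\<bar> < \<gamma>"
      by (simp add: additive.zero[OF add[OF f]])
  qed
  then obtain d where d: "d > 0" "\<And>y f. dist y 0 < d \<Longrightarrow> f \<in> \<F> \<Longrightarrow> \<bar>f y\<bar> < \<gamma>"
    by (auto simp: eventually_nhds_metric)
  \<comment> \<open>\<open>d\<close> depends only on the functionals and \<open>\<gamma>\<close>, so
    it is available before the blocks. Each block gets \<open>d / 2\<close> because
    \<open>v B\<close> is a difference of two charges.\<close>
  obtain \<P> where \<P>: "finite \<P>" "\<P> \<subseteq> sets M" "disjoint \<P>" and A_eq: "\<Union>\<P> = A"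
    and small: "\<And>B. B \<in> \<P> \<Longrightarrow> small_on (d / 2) B"
    using narrow_imp_splits_small[OF narrow A, of "d / 2"] d(1) by (auto simp: splits_small_def)
  \<comment> \<open>One such error per block sums to less than \<open>\<epsilon> / 2\<close> for
    \<open>m'\<close>, whatever signs are chosen afterwards.\<close>
  define \<epsilon>' where "\<epsilon>' = \<epsilon> / (2 * (1 + real (card \<P>)))"
  have \<epsilon>': "\<epsilon>' > 0"
    using \<epsilon> by (simp add: \<epsilon>'_def)
  have "\<forall>B\<in>\<P>. \<exists>C. C \<in> sets M \<and> C \<subseteq> B \<and> measure M C = measure M (B - C) \<and>
      dist (m' C) (m' (B - C)) < \<epsilon>'"
    using narrow' \<epsilon>' \<P>(2) unfolding narrow_charge_def by blast
  then obtain C where C: "\<And>B. B \<in> \<P> \<Longrightarrow> C B \<in> sets M" "\<And>B. B \<in> \<P> \<Longrightarrow> C B \<subseteq> B"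
    and half: "\<And>B. B \<in> \<P> \<Longrightarrow> measure M (C B) = measure M (B - C B)"
    and small': "\<And>B. B \<in> \<P> \<Longrightarrow> dist (m' (C B)) (m' (B - C B)) < \<epsilon>'"
    by metis
  define v where "v B = m (C B) - m (B - C B)" for B
  have v_small: "\<bar>f (v B)\<bar> < \<gamma>" if B: "B \<in> \<P>" and f: "f \<in> \<F>" for B f
  proof (rule d(2)[OF _ f])
    have "dist (v B) 0 \<le> dist (m (C B)) 0 + dist (m (B - C B)) 0"
      unfolding v_def dist_diff_zero by (rule dist_triangle2)
    also have "\<dots> < d / 2 + d / 2"
      using small[OF B] C[OF B] B \<P>(2) by (intro add_strict_mono) (auto simp: small_on_def)
    finally show "dist (v B) 0 < d" by simp
  qed
  \<comment> \<open>Each block is viewed as the vector of values of all functionals at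
    \<open>v B\<close>, so one choice of signs balances all of them at once.\<close>
  obtain \<theta> where \<theta>: "\<forall>B. \<theta> B \<in> {1, -1::real}"
    "(\<Sum>f\<in>\<F>. (\<Sum>B\<in>\<P>. \<theta> B * f (v B))\<^sup>2) \<le> (\<Sum>B\<in>\<P>. \<Sum>f\<in>\<F>. (f (v B))\<^sup>2)"
    using ex_signs_sum_squares_le[OF \<P>(1), where I = \<F> and v = "\<lambda>B f. f (v B)"] by blast
  define s where "s B \<longleftrightarrow> \<theta> B = 1" for B
  define D where "D = select \<P> C s"
  have D: "D \<in> sets M" "A - D \<in> sets M"
    unfolding D_def using \<P> C A by (auto intro!: select_in_sets sets.Diff)
  have "D \<subseteq> A"
    unfolding D_def A_eq[symmetric] using C(2) by (fastforce simp: select_def split: if_splits)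
  moreover have "measure M D = measure M (A - D)"
    unfolding D_def A_eq[symmetric]
    using \<P> C half by (simp add: Union_Diff_select measure_select[OF M])
  moreover have "dist (m' D) (m' (A - D)) < \<epsilon> / 2"
  proof -
    have "m' D - m' (A - D) =
        (\<Sum>B\<in>\<P>. if s B then m' (C B) - m' (B - C B) else - (m' (C B) - m' (B - C B)))"
      unfolding D_def A_eq[symmetric] using \<P> C by (rule m'.charge_select)
    then have "dist (m' D) (m' (A - D)) =
        dist (\<Sum>B\<in>\<P>. if s B then m' (C B) - m' (B - C B) else - (m' (C B) - m' (B - C B))) 0"
      by (metis dist_diff_zero)
    also have "\<dots> \<le> (\<Sum>B\<in>\<P>. dist (if s B then m' (C B) - m' (B - C B) else - (m' (C B) - m' (B - C B))) 0)"
      by (rule dist_sum_le)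
    also have "\<dots> \<le> (\<Sum>B\<in>\<P>. \<epsilon>')"
      by (intro sum_mono) (simp add: dist_minus_zero dist_diff_zero small' less_imp_le del: minus_diff_eq)
    also have "\<dots> < \<epsilon> / 2"
      using \<epsilon> by (simp add: \<epsilon>'_def field_simps)
    finally show ?thesis .
  qed
  moreover have "dist (m D) (m (A - D)) < \<epsilon> / 2"
  proof -
    have "\<bar>f (m D - m (A - D))\<bar> \<le> 1 / 2" if f: "f \<in> \<F>" for f
    proof -
      have "m D - m (A - D) = (\<Sum>B\<in>\<P>. if s B then v B else - v B)"
        unfolding D_def A_eq[symmetric] v_def using \<P> C by (rule charge_select)
      then have "f (m D - m (A - D)) = (\<Sum>B\<in>\<P>. f (if s B then v B else - v B))"
        by (simp only: additive.sum[OF add[OF f]])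
      also have "\<dots> = (\<Sum>B\<in>\<P>. \<theta> B * f (v B))"
        using \<theta>(1) by (intro sum.cong) (auto simp: s_def additive.minus[OF add[OF f]])
      finally have "(f (m D - m (A - D)))\<^sup>2 = (\<Sum>B\<in>\<P>. \<theta> B * f (v B))\<^sup>2"
        by simp
      also have "\<dots> \<le> (\<Sum>f\<in>\<F>. (\<Sum>B\<in>\<P>. \<theta> B * f (v B))\<^sup>2)"
        using \<F> f by (intro member_le_sum) auto
      also have "\<dots> \<le> (\<Sum>f\<in>\<F>. \<Sum>B\<in>\<P>. (f (v B))\<^sup>2)"
        using \<theta>(2) by (subst sum.swap)
      \<comment> \<open>In each square one factor is below \<open>\<gamma>\<close> by smallness of
        the blocks; the sum of the other factors is bounded by \<open>b f\<close>, which was fixed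
        before the partition.\<close>
      also have "\<dots> \<le> (\<Sum>f\<in>\<F>. \<gamma> * b f)"
      proof (rule sum_mono)
        fix g assume g: "g \<in> \<F>"
        have "(\<Sum>B\<in>\<P>. (g (v B))\<^sup>2) \<le> (\<Sum>B\<in>\<P>. \<gamma> * \<bar>g (v B)\<bar>)"
        proof (rule sum_mono)
          fix B assume "B \<in> \<P>"
          then have "\<bar>g (v B)\<bar> * \<bar>g (v B)\<bar> \<le> \<gamma> * \<bar>g (v B)\<bar>"
            using v_small[OF _ g, of B] by (intro mult_right_mono) auto
          then show "(g (v B))\<^sup>2 \<le> \<gamma> * \<bar>g (v B)\<bar>"
            by (simp add: power2_eq_square)
        qed
        also have "\<dots> \<le> \<gamma> * b g"
          unfolding sum_distrib_left[symmetric] v_def using \<gamma>(1)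
          by (intro mult_left_mono sum_abs_functional_bounded[OF add[OF g] b[OF g] \<P> C]) auto
        finally show "(\<Sum>B\<in>\<P>. (g (v B))\<^sup>2) \<le> \<gamma> * b g" .
      qed
      also have "\<dots> \<le> (1 / 2)\<^sup>2"
        using \<gamma>(2) by (simp add: sum_distrib_left[symmetric] power2_eq_square)
      finally show ?thesis
        by (subst (asm) abs_le_square_iff[symmetric]) simp
    qed
    then have "dist (m D - m (A - D)) 0 < \<epsilon> / 2"
      using D by (intro detect charge_diff_in_K) auto
    then show ?thesis
      by (simp add: dist_diff_zero)
  qed
  ultimately show "\<exists>D\<in>sets M. D \<subseteq> A \<and> measure M D = measure M (A - D) \<and>
      dist (m' D + m D) (m' (A - D) + m (A - D)) < \<epsilon>"
    using D(1) dist_add_le[of "m' D" "m D" "m' (A - D)" "m (A - D)"]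
    by (intro bexI[of _ D]) auto
qed

end

section \<open>Operators on Koethe F-spaces\<close>

locale Koethe_operator = metric_F_space scl
  for scl :: "'k::real_or_complex \<Rightarrow> 'y::{ab_group_add, metric_space} \<Rightarrow> 'y" +
  fixes M :: "'a measure" and X :: "('a \<Rightarrow> 'k) set" and \<rho> and T :: "('a \<Rightarrow> 'k) \<Rightarrow> 'y"
  assumes finite_M: "finite_measure M"
    and Koethe: "Koethe_F_space M X \<rho>"
    and operator: "continuous_linear_operator X \<rho> scl T"
begin

sublocale X: F_space fun_scl X "ae_zero M" \<rho>
  using Koethe by (simp add: Koethe_F_space_def)

lemma dominated_in_X:
  assumes "x \<in> borel_measurable M" "y \<in> X" "AE t in M. norm (x t) \<le> norm (y t)"
  shows "x \<in> X"
  using Koethe assms by (auto simp: Koethe_F_space_def)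

lemma indicator_in_X:
  assumes "A \<in> sets M"
  shows "indicator A \<in> X"
proof (rule dominated_in_X)
  show "indicator (space M) \<in> X"
    using Koethe by (simp add: Koethe_F_space_def)
  show "AE t in M. norm (indicator A t :: 'k) \<le> norm (indicator (space M) t :: 'k)"
    by (auto simp: indicator_def)
qed (use assms in simp)

lemma T_add: "x \<in> X \<Longrightarrow> y \<in> X \<Longrightarrow> T (x + y) = T x + T y"
  using operator by (simp add: continuous_linear_operator_def)

lemma T_diff:
  assumes "x \<in> X" "y \<in> X"
  shows "T (x - y) = T x - T y"
  using T_add[of "x - y" y] assms X.subspace_diff[OF X.subspace_V] by simp

text \<open>The functions are at distance zero, hence within every \<open>\<delta>\<close> of each
  other; continuity at \<open>y\<close> with the distance of the two images as tolerance gives the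
  contradiction.\<close>

lemma T_cong_AE:
  assumes x: "x \<in> X" and y: "y \<in> X" and eq: "AE t in M. x t = y t"
  shows "T x = T y"
proof (rule ccontr)
  assume "T x \<noteq> T y"
  then have "\<exists>\<delta>>0. \<forall>z\<in>X. \<rho> z y < \<delta> \<longrightarrow> dist (T z) (T y) < dist (T x) (T y)"
    using operator y by (auto simp: continuous_linear_operator_def)
  moreover have "\<rho> x y = 0"
    using eq by (subst X.zero_iff[OF x y]) (simp add: ae_zero_def)
  ultimately show False
    using x by force
qed

lemma vector_charge_operator: "vector_charge scl M (\<lambda>A. T (indicator A))"
proof
  fix A B assume *: "A \<in> sets M" "B \<in> sets M" "A \<inter> B = {}"
  then have "(indicator (A \<union> B) :: 'a \<Rightarrow> 'k) = indicator A + indicator B"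
    by (auto simp: fun_eq_iff indicator_def)
  then show "T (indicator (A \<union> B)) = T (indicator A) + T (indicator B)"
    using * by (simp add: T_add indicator_in_X)
qed

lemma integral_indicator_diff:
  assumes "C \<in> sets M" "D \<in> sets M"
  shows "(\<integral>t. indicator C t - indicator D t \<partial>M) = (of_real (measure M C - measure M D) :: 'k)"
proof -
  have "has_bochner_integral M (\<lambda>t. indicator A t :: 'k) (of_real (measure M A))"
    if "A \<in> sets M" for A
  proof -
    have "has_bochner_integral M (\<lambda>t. indicator A t *\<^sub>R (1 :: 'k)) (measure M A *\<^sub>R 1)"
      using that finite_measure.emeasure_finite[OF finite_M, of A]
      by (intro has_bochner_integral_indicator) (simp_all add: less_top)
    also have "(\<lambda>t. indicator A t *\<^sub>R (1 :: 'k)) = indicator A"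
      by (auto simp: fun_eq_iff indicator_def)
    finally show ?thesis
      by (simp add: of_real_def)
  qed
  from has_bochner_integral_diff[OF this[OF assms(1)] this[OF assms(2)]] show ?thesis
    by (simp add: has_bochner_integral_integral_eq)
qed

lemma narrow_operator_imp_narrow_charge:
  assumes narrow: "narrow_operator M X \<rho> scl T"
  shows "narrow_charge M (\<lambda>A. T (indicator A))"
  unfolding narrow_charge_def
proof (intro ballI allI impI)
  fix A and \<epsilon> :: real assume A: "A \<in> sets M" and \<epsilon>: "\<epsilon> > 0"
  show "\<exists>C\<in>sets M. C \<subseteq> A \<and> measure M C = measure M (A - C) \<and>
      dist (T (indicator C)) (T (indicator (A - C))) < \<epsilon>"
  proof (cases "emeasure M A = 0")
    \<comment> \<open>On a null set the empty half works, since all indicators of its subsets have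
      the same image.\<close>
    case True
    then have "A \<in> null_sets M"
      using A by blast
    then have "AE t in M. (indicator {} t :: 'k) = indicator A t"
      by (auto dest!: AE_not_in simp: indicator_def)
    then have "T (indicator {}) = T (indicator A)"
      using A by (intro T_cong_AE indicator_in_X) auto
    then show ?thesis
      using True \<epsilon> by (intro bexI[of _ "{}"]) (auto simp: measure_def)
  next
    case False
    then obtain x where x: "sign_on M A x" "mean_zero M x" "dist (T x) 0 < \<epsilon>"
      using narrow A \<epsilon> unfolding narrow_operator_def by (metis not_gr_zero)
    have x_meas: "x \<in> borel_measurable M"
      using x(1) by (simp add: sign_on_def is_sign_def)
    define C where "C = A \<inter> (x -` {1} \<inter> space M)"
    have C: "C \<in> sets M" "A - C \<in> sets M" "C \<subseteq> A"
      unfolding C_def using A measurable_sets[OF x_meas, of "{1}"] by auto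
    have "AE t in M. x t \<in> {-1, 0, 1}" "AE t in M. x t \<noteq> 0 \<longleftrightarrow> t \<in> A"
      using x(1) by (auto simp: sign_on_def is_sign_def)
    then have eq: "AE t in M. x t = indicator C t - indicator (A - C) t"
      using AE_space by eventually_elim (auto simp: C_def indicator_def)
    have diff: "(indicator C - indicator (A - C) :: 'a \<Rightarrow> 'k) \<in> X"
      using C by (intro X.subspace_diff[OF X.subspace_V] indicator_in_X)
    \<comment> \<open>Being a sign does not by itself place \<open>x\<close> in \<open>X\<close>;
      membership follows from domination by the difference of indicators.\<close>
    have "x \<in> X"
      using eq by (intro dominated_in_X[OF x_meas diff]) auto
    then have "T x = T (indicator C - indicator (A - C))"
      using diff eq by (intro T_cong_AE) auto
    then have "dist (T (indicator C)) (T (indicator (A - C))) < \<epsilon>"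
      using x(3) C by (simp add: T_diff indicator_in_X dist_diff_zero)
    moreover have "(\<integral>t. x t \<partial>M) = (\<integral>t. indicator C t - indicator (A - C) t \<partial>M)"
      using x_meas C eq by (intro integral_cong_AE) auto
    then have "measure M C = measure M (A - C)"
      using x(2) C by (simp add: mean_zero_def integral_indicator_diff del: of_real_diff)
    ultimately show ?thesis
      using C by blast
  qed
qed

lemma narrow_charge_imp_narrow_operator:
  assumes narrow: "narrow_charge M (\<lambda>A. T (indicator A))"
  shows "narrow_operator M X \<rho> scl T"
  unfolding narrow_operator_def
proof (intro conjI ballI allI impI operator)
  fix A and \<epsilon> :: real assume A: "A \<in> sets M" and \<epsilon>: "\<epsilon> > 0"
  obtain C where C: "C \<in> sets M" "C \<subseteq> A" "measure M C = measure M (A - C)"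
    "dist (T (indicator C)) (T (indicator (A - C))) < \<epsilon>"
    using narrow A \<epsilon> unfolding narrow_charge_def by blast
  have AC: "A - C \<in> sets M"
    using A C by blast
  define x :: "'a \<Rightarrow> 'k" where "x = indicator C - indicator (A - C)"
  have "x = (\<lambda>t. indicator C t - indicator (A - C) t)"
    by (simp add: x_def fun_eq_iff)
  then have "x \<in> borel_measurable M"
    using C AC by simp
  then have "sign_on M A x"
    using C(2) by (auto simp: sign_on_def is_sign_def x_def indicator_def intro!: AE_I2)
  moreover have "mean_zero M x"
    using C AC integral_indicator_diff[of C "A - C"] by (simp add: mean_zero_def x_def)
  moreover have "dist (T x) 0 < \<epsilon>"
    using C AC by (simp add: x_def T_diff indicator_in_X dist_diff_zero)
  ultimately show "\<exists>x. sign_on M A x \<and> mean_zero M x \<and> dist (T x) 0 < \<epsilon>"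
    by blast
qed

lemma indicator_diff_sign:
  assumes "C \<in> sets M" "D \<in> sets M" "C \<inter> D = {}"
  shows "(indicator C - indicator D :: 'a \<Rightarrow> 'k) \<in> {x \<in> X. is_sign M x}"
proof -
  have "(indicator C - indicator D :: 'a \<Rightarrow> 'k) = (\<lambda>t. indicator C t - indicator D t)"
    by (simp add: fun_eq_iff)
  then have "(indicator C - indicator D :: 'a \<Rightarrow> 'k) \<in> borel_measurable M"
    using assms by simp
  moreover have "(indicator C - indicator D :: 'a \<Rightarrow> 'k) t \<in> {-1, 0, 1}" for t
    using assms(3) by (auto simp: indicator_def)
  ultimately show ?thesis
    using assms by (simp add: is_sign_def indicator_in_X X.subspace_diff[OF X.subspace_V])
qed

text \<open>Differences of the charge on disjoint sets are images of the signs
  \<open>indicator C - indicator D\<close>, so they lie in the compact closure.\<close>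

lemma compact_vector_charge_operator:
  assumes "compact (closure (T ` {x \<in> X. is_sign M x}))"
  shows "compact_vector_charge scl M (\<lambda>A. T (indicator A)) (closure (T ` {x \<in> X. is_sign M x}))"
proof (intro compact_vector_charge.intro compact_vector_charge_axioms.intro vector_charge_operator assms)
  fix C D assume *: "C \<in> sets M" "D \<in> sets M" "C \<inter> D = {}"
  have "T (indicator C - indicator D) \<in> T ` {x \<in> X. is_sign M x}"
    using indicator_diff_sign[OF *] by (rule imageI)
  with closure_subset have "T (indicator C - indicator D) \<in> closure (T ` {x \<in> X. is_sign M x})"
    by (rule subsetD)
  then show "T (indicator C) - T (indicator D) \<in> closure (T ` {x \<in> X. is_sign M x})"
    using * by (simp add: T_diff indicator_in_X)
qed

end

lemma continuous_linear_operator_add: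
  fixes scl :: "'k::real_or_complex \<Rightarrow> 'y::{ab_group_add, metric_space} \<Rightarrow> 'y"
  assumes F: "metric_F_space scl"
    and T: "continuous_linear_operator X \<rho> scl T" and S: "continuous_linear_operator X \<rho> scl S"
  shows "continuous_linear_operator X \<rho> scl (\<lambda>x. T x + S x)"
proof -
  interpret metric_F_space scl by (fact F)
  show ?thesis
    unfolding continuous_linear_operator_def
  proof (intro conjI ballI allI impI)
    fix x y assume "x \<in> X" "y \<in> X"
    then show "T (x + y) + S (x + y) = T x + S x + (T y + S y)"
      using T S by (simp add: continuous_linear_operator_def algebra_simps)
  next
    fix c x assume "x \<in> X"
    then show "T (fun_scl c x) + S (fun_scl c x) = scl c (T x + S x)"
      using T S by (simp add: continuous_linear_operator_def scale_right_distrib)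
  next
    fix x and \<epsilon> :: real assume x: "x \<in> X" and \<epsilon>: "\<epsilon> > 0"
    obtain d where d: "d > 0" "\<forall>y\<in>X. \<rho> y x < d \<longrightarrow> dist (T y) (T x) < \<epsilon> / 2"
      using T x \<epsilon> half_gt_zero unfolding continuous_linear_operator_def by metis
    obtain e where e: "e > 0" "\<forall>y\<in>X. \<rho> y x < e \<longrightarrow> dist (S y) (S x) < \<epsilon> / 2"
      using S x \<epsilon> half_gt_zero unfolding continuous_linear_operator_def by metis
    have "dist (T y + S y) (T x + S x) < \<epsilon>" if "y \<in> X" "\<rho> y x < min d e" for y
      using dist_add_le[of "T y" "S y" "T x" "S x"] d(2)[rule_format, of y] e(2)[rule_format, of y] that
      by simp
    then show "\<exists>\<delta>>0. \<forall>y\<in>X. \<rho> y x < \<delta> \<longrightarrow> dist (T y + S y) (T x + S x) < \<epsilon>"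
      using d(1) e(1) by (intro exI[of _ "min d e"]) simp
  qed
qed

theorem theorem5p3:
  fixes M :: "'a measure"
    and X Z :: "('a \<Rightarrow> 'k::real_or_complex) set"
    and \<rho> :: "('a \<Rightarrow> 'k) \<Rightarrow> ('a \<Rightarrow> 'k) \<Rightarrow> real"
    and scl :: "'k \<Rightarrow> 'y::{ab_group_add, metric_space} \<Rightarrow> 'y"
    and T\<^sub>1 T\<^sub>2 :: "('a \<Rightarrow> 'k) \<Rightarrow> 'y"
  assumes "finite_measure M" and "atomless M"
    and "Koethe_F_space M X \<rho>"
    and "Z = {x \<in> X. is_sign M x}"
    and "F_space scl UNIV {0} dist" and "locally_convex scl"
    and "narrow_operator M X \<rho> scl T\<^sub>1"
    and "narrow_operator M X \<rho> scl T\<^sub>2"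
    and "compact (closure (T\<^sub>2 ` Z))"
  shows "narrow_operator M X \<rho> scl (\<lambda>x. T\<^sub>1 x + T\<^sub>2 x)"
proof -
  interpret Y: metric_F_space scl
    using assms(5) by (rule metric_F_space.intro)
  have operator: "Koethe_operator scl M X \<rho> T" if "continuous_linear_operator X \<rho> scl T" for T
    using assms(1,3) that Y.metric_F_space_axioms
    by (intro Koethe_operator.intro Koethe_operator_axioms.intro)
  have op: "continuous_linear_operator X \<rho> scl T\<^sub>1" "continuous_linear_operator X \<rho> scl T\<^sub>2"
    using assms(7,8) by (auto simp: narrow_operator_def)
  interpret T1: Koethe_operator scl M X \<rho> T\<^sub>1
    using op(1) by (rule operator)
  interpret T2: Koethe_operator scl M X \<rho> T\<^sub>2
    using op(2) by (rule operator)
  interpret T: Koethe_operator scl M X \<rho> "\<lambda>x. T\<^sub>1 x + T\<^sub>2 x"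
    using continuous_linear_operator_add[OF Y.metric_F_space_axioms op] by (rule operator)
  interpret m2: compact_vector_charge scl M "\<lambda>A. T\<^sub>2 (indicator A)" "closure (T\<^sub>2 ` Z)"
    using T2.compact_vector_charge_operator assms(4,9) by simp
  \<comment> \<open>The charge of the sum operator is the pointwise sum of the two charges, so
    narrowness is carried to charges, added there, and carried back.\<close>
  show ?thesis
    using assms(1,6,7,8)
    by (intro T.narrow_charge_imp_narrow_operator m2.narrow_charge_add
        T1.vector_charge_operator T1.narrow_operator_imp_narrow_charge
        T2.narrow_operator_imp_narrow_charge)
qed

end
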